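(* Let $r \geq 1$, $s \geq 1$, $0 \leq t \leq s-1$ be integers, and suppose that the $6$-regular toroidal triangulation $G = T(r,s,t)$ is simple. Let $n = rs$ be the order of $G$, and let $a \geq b \geq c$ be the lengths of its three normal circuits. Suppose that $\left(\frac{n}{a}, \frac{n}{b}\right) \neq (1,1)$ and $\left(\frac{n}{a}, \frac{n}{b}\right) \neq (1,2)$. Then $G$ can be $4$-colored, i.e. $G$ has a proper vertex coloring with at most $4$ colors.
   Context: Definition of $T(r,s,t)$: for integers $r \geq 1$, $s \geq 1$, $0 \leq t \leq s-1$, the graph $T(r,s,t)$ (possibly with loops or multiple edges) has vertex set $\{(i,j) : 1 \leq i \leq r,\ 1 \leq j \leq s\}$, where first coordinates are read modulo $r$ and second coordinates modulo $s$, with the following adjacencies (each vertex has six listed neighbours): - for $1 < i < r$, $(i,j)$ is adjacent to $(i, j \pm 1)$, $(i \pm 1, j)$ and $(i \pm 1, j \mp 1)$; - if $r > 1$, $(1,j)$ is adjacent to $(1, j \pm 1)$, $(2,j)$, $(2,j-1)$, $(r, j+t+1)$ and $(r, j+t)$; - if $r > 1$, $(r,j)$ is adjacent to $(r, j \pm 1)$, $(r-1, j+1)$, $(r-1,j)$, $(1, j-t)$ and $(1, j-t-1)$; - if $r = 1$, $(1,j)$ is adjacent to $(1, j \pm 1)$, $(1, j \pm t)$ and $(1, j \pm (t+1))$. $T(r,s,t)$ is simple if it has no loops and no multiple edges, i.e. for every vertex the six listed neighbours are pairwise distinct and different from the vertex itself. Normal circuits: through every vertex of $T(r,s,t)$ there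 are three normal circuits, the simple cycles obtained by traversing through the vertex along each of the three directions (vertical, horizontal, diagonal). With $n = rs$, their lengths are $s$, $\frac{n}{\gcd(s,t)}$ and $\frac{n}{\gcd(s,r+t)}$ respectively (with $\gcd(s,0) = s$), independent of the vertex. *)

theory Defs
  imports Complex_Main "HOL-Library.Multiset" "HOL-Combinatorics.Orbits"
begin

type_synonym vertex = "int \<times> int"

text \<open>
  The representative of \<open>x\<close> modulo \<open>m\<close> in the range \<open>1, \<dots>, m\<close>.
\<close>
definition wrap :: "int \<Rightarrow> int \<Rightarrow> int" where
  "wrap m x = (x - 1) mod m + 1"

definition T_verts :: "int \<Rightarrow> int \<Rightarrow> vertex set" where
  "T_verts r s = {1..r} \<times> {1..s}"

text \<open>
  The list, with multiplicities, of the six neighbours of a vertex of \<open>T(r,s,t)\<close>. A repeated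
  entry is a multiple edge, and an entry equal to the vertex itself is a loop. The first
  coordinates below never leave \<open>1, \<dots>, r\<close>, so only the second coordinate has to be reduced.
\<close>
definition T_nbrs :: "int \<Rightarrow> int \<Rightarrow> int \<Rightarrow> vertex \<Rightarrow> vertex list" where
  "T_nbrs r s t = (\<lambda>(i, j). map (\<lambda>(x, y). (x, wrap s y))
     (if r = 1 then
        [(1, j + 1), (1, j - 1), (1, j + t), (1, j - t), (1, j + (t + 1)), (1, j - (t + 1))]
      else if i = 1 then
        [(1, j + 1), (1, j - 1), (2, j), (2, j - 1), (r, j + t + 1), (r, j + t)]
      else if i = r then
        [(r, j + 1), (r, j - 1), (r - 1, j + 1), (r - 1, j), (1, j - t), (1, j - t - 1)]
      else
        [(i, j + 1), (i, j - 1), (i + 1, j), (i - 1, j), (i + 1, j - 1), (i - 1, j + 1)]))"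

definition T_adj :: "int \<Rightarrow> int \<Rightarrow> int \<Rightarrow> vertex \<Rightarrow> vertex \<Rightarrow> bool" where
  "T_adj r s t v w \<longleftrightarrow> w \<in> set (T_nbrs r s t v)"

definition T_simple :: "int \<Rightarrow> int \<Rightarrow> int \<Rightarrow> bool" where
  "T_simple r s t \<longleftrightarrow>
     (\<forall>v \<in> T_verts r s. distinct (T_nbrs r s t v) \<and> v \<notin> set (T_nbrs r s t v))"

datatype direction = Vertical | Horizontal | Diagonal

text \<open>
  One step along each of the three directions. Passing from column \<open>r\<close> back to column \<open>1\<close> shifts
  the second coordinate by \<open>-t\<close>, as in the adjacencies between these two columns; for \<open>r = 1\<close>
  every horizontal or diagonal step does so.
\<close>
fun T_step :: "int \<Rightarrow> int \<Rightarrow> int \<Rightarrow> direction \<Rightarrow> vertex \<Rightarrow> vertex" where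
  "T_step r s t Vertical (i, j) = (i, wrap s (j + 1))"
| "T_step r s t Horizontal (i, j) =
     (if i = r then (1, wrap s (j - t)) else (i + 1, wrap s j))"
| "T_step r s t Diagonal (i, j) =
     (if i = r then (1, wrap s (j - t - 1)) else (i + 1, wrap s (j - 1)))"

text \<open>
  Each step permutes the finite vertex set, so its orbit through a vertex is the vertex set of a
  cycle, and the length of that cycle is the number of its vertices.
\<close>
definition normal_circuit :: "int \<Rightarrow> int \<Rightarrow> int \<Rightarrow> direction \<Rightarrow> vertex \<Rightarrow> vertex set" where
  "normal_circuit r s t d v = orbit (T_step r s t d) v"

definition normal_circuit_length :: "int \<Rightarrow> int \<Rightarrow> int \<Rightarrow> direction \<Rightarrow> vertex \<Rightarrow> nat" where
  "normal_circuit_length r s t d v = card (normal_circuit r s t d v)"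

definition colorable :: "nat \<Rightarrow> 'a set \<Rightarrow> ('a \<Rightarrow> 'a \<Rightarrow> bool) \<Rightarrow> bool" where
  "colorable k V adj \<longleftrightarrow>
     (\<exists>col :: 'a \<Rightarrow> nat. (\<forall>v \<in> V. col v < k) \<and>
        (\<forall>v \<in> V. \<forall>w \<in> V. adj v w \<longrightarrow> col v \<noteq> col w))"

lemma wrap_mem: "s \<ge> 1 \<Longrightarrow> wrap s x \<in> {1..s}"
  using pos_mod_bound[of s "x - 1"] pos_mod_sign[of s "x - 1"]
  by (auto simp: wrap_def add1_zle_eq simp del: pos_mod_bound pos_mod_sign)

lemma T_step_closed:
  assumes "s \<ge> 1" "v \<in> T_verts r s"
  shows "T_step r s t d v \<in> T_verts r s"
  using assms(2) wrap_mem[OF assms(1)] by (cases v; cases d) (auto simp: T_verts_def)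

lemma T_step_adj:
  assumes "v \<in> T_verts r s"
  shows "T_adj r s t v (T_step r s t d v)"
  using assms
  by (cases v; cases d) (auto simp: T_adj_def T_nbrs_def T_verts_def diff_diff_eq)

end

theory Submission
  imports Defs
begin

text \<open>
  Unrolled to the plane, \<open>T(r,s,t)\<close> is the triangular lattice modulo the periods \<open>(0,s)\<close> and \<open>(r,t)\<close>,
  and the numbers of parallel normal circuits are \<open>r\<close>, \<open>g = gcd s t\<close> and \<open>h = gcd s (r + t)\<close>. The
  hypotheses say that any two of these have a product greater than 2; by the symmetries of the
  lattice we may assume that \<open>r\<close> is the largest.

  The main coloring has all points of color 3 on walks that, from one column to the next, move by
  \<open>+1\<close> or \<open>-2\<close>; between consecutive walks a column is colored \<open>012012\<dots>\<close>. Adjacent columns are then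
  compatible whenever the walks stay at distances of at least 4 that are \<open>1\<close> modulo 3. Walks of
  constant average slope close up if a linear inequality has a solution with prescribed residues
  modulo 3; for \<open>d\<close> walks with \<open>4 d \<le> s\<close> and \<open>s - 1 \<le> r d\<close> this is automatic. Apart from tori with
  \<open>r, s\<close> even, with \<open>4\<close> dividing \<open>r\<close> or \<open>s\<close>, or with \<open>r \<le> 3\<close>, which are easy, this leaves lengths
  \<open>s \<in> {3, 5, 6, 9}\<close> and finitely many other cases. Almost all of these are settled by the same coloring
  along another direction or with a specific slope; \<open>T(5,5,0)\<close> is not, and is colored by hand.
\<close>

section \<open>Periodic colorings of the triangular lattice\<close>

definition period :: "(int \<Rightarrow> int \<Rightarrow> int) \<Rightarrow> int \<Rightarrow> int \<Rightarrow> bool" where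
  "period f a b \<longleftrightarrow> (\<forall>x y. f (x + a) (y + b) = f x y)"

definition lattice_coloring :: "(int \<Rightarrow> int \<Rightarrow> int) \<Rightarrow> bool" where
  "lattice_coloring f \<longleftrightarrow> (\<forall>x y. 0 \<le> f x y \<and> f x y < 4 \<and>
     f x y \<noteq> f x (y + 1) \<and> f x y \<noteq> f (x + 1) y \<and> f x y \<noteq> f (x + 1) (y - 1))"

text \<open>Any integer \<open>t\<close> is allowed, so mirrored and rotated tori, whose shift may
  be negative, need no normalization.\<close>

definition torus_colorable :: "int \<Rightarrow> int \<Rightarrow> int \<Rightarrow> bool" where
  "torus_colorable r s t \<longleftrightarrow> (\<exists>f. lattice_coloring f \<and> period f 0 s \<and> period f r t)"

lemma period_uminus: "period f a b \<Longrightarrow> period f (- a) (- b)"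
  unfolding period_def by (metis add_uminus_conv_diff diff_add_cancel)

lemma period_add: "period f a b \<Longrightarrow> period f c d \<Longrightarrow> period f (a + c) (b + d)"
  unfolding period_def by (metis add.assoc)

lemma period_mult_nat: "period f a b \<Longrightarrow> period f (int n * a) (int n * b)"
proof (induction n)
  case 0
  show ?case by (simp add: period_def)
next
  case (Suc n)
  then show ?case
    using period_add[of f a b "int n * a" "int n * b"] by (simp add: algebra_simps)
qed

lemma period_mult: "period f a b \<Longrightarrow> period f (k * a) (k * b)"
  by (cases k rule: int_cases2)
    (use period_mult_nat period_uminus in \<open>fastforce+\<close>)

lemma period_combination:
  assumes "period f 0 s" "period f r t"
  shows "period f (k * r) (k * t + m * s)"
  using period_add[OF period_mult[OF assms(2), of k] period_mult[OF assms(1), of m]] by simp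

lemma torus_colorableI:
  "lattice_coloring f \<Longrightarrow> period f 0 s \<Longrightarrow> period f r t \<Longrightarrow> torus_colorable r s t"
  unfolding torus_colorable_def by blast

lemma torus_colorable_mod:
  assumes "torus_colorable r s (t mod s)"
  shows "torus_colorable r s t"
proof -
  obtain f where f: "lattice_coloring f" "period f 0 s" "period f r (t mod s)"
    using assms torus_colorable_def by blast
  have "period f r t"
    using period_combination[OF f(2,3), of 1 "t div s"] by (simp add: add.commute)
  with f show ?thesis by (blast intro: torus_colorableI)
qed

lemma torus_colorable_modI:
  fixes t :: int
  assumes "t mod s = u" "torus_colorable r s u"
  shows "torus_colorable r s t"
  using assms torus_colorable_mod by simp

text \<open>The map from \<open>(x, y)\<close> to \<open>(x, - x - y)\<close> preserves the
  triangular lattice, maps every column to itself and swaps horizontal with diagonal edges. It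
  exchanges the counts \<open>gcd s t\<close> and \<open>gcd s (r + t)\<close>.\<close>

lemma torus_colorable_mirror:
  assumes "torus_colorable r s (- r - t)"
  shows "torus_colorable r s t"
proof -
  obtain f where f: "lattice_coloring f" "period f 0 s" "period f r (- r - t)"
    using assms torus_colorable_def by blast
  define g where "g = (\<lambda>x y. f x (- x - y))"
  have p: "period f 0 (- s)"
    using period_uminus[OF f(2)] by simp
  have fs: "f (x + 1) (y - 1) \<noteq> f x y" "f (x + 1) y \<noteq> f x y" "f x (y + 1) \<noteq> f x y" "0 \<le> f x y" "f x y < 4" for x y
    using f(1) unfolding lattice_coloring_def by metis+
  have "lattice_coloring g"
    unfolding lattice_coloring_def g_def
  proof (intro allI conjI)
    fix x y
    show "f x (- x - y) \<noteq> f x (- x - (y + 1))"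
      using fs(3)[of x "- x - (y + 1)"] by (simp add: algebra_simps)
    show "f x (- x - y) \<noteq> f (x + 1) (- (x + 1) - y)"
      using fs(1)[of x "- x - y"] by (metis diff_diff_eq add.commute minus_add_distrib uminus_add_conv_diff)
    show "f x (- x - y) \<noteq> f (x + 1) (- (x + 1) - (y - 1))"
      using fs(2)[of x "- x - y"] by (simp add: algebra_simps)
  qed (use fs in auto)
  moreover have "period g 0 s"
    unfolding period_def g_def
  proof (intro allI)
    fix x y
    show "f (x + 0) (- (x + 0) - (y + s)) = f x (- x - y)"
      using p[unfolded period_def, rule_format, of x "- x - y"] by (simp add: diff_diff_eq)
  qed
  moreover have "period g r t"
    unfolding period_def g_def
  proof (intro allI)
    fix x y
    show "f (x + r) (- (x + r) - (y + t)) = f x (- x - y)"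
      using f(3)[unfolded period_def, rule_format, of x "- x - y"] by (simp add: algebra_simps)
  qed
  ultimately show ?thesis by (rule torus_colorableI)
qed

text \<open>
  Rotating the triangular lattice by sixty degrees turns the \<open>g\<close> horizontal circuits of \<open>T(r,s,t)\<close>
  into the columns of the representation on the left.
\<close>
lemma torus_colorable_rotate:
  assumes "torus_colorable g (r * a) (r * k - g)" "1 + b * k = m * a"
  shows "torus_colorable r (g * a) (g * b)"
proof -
  obtain f where f: "lattice_coloring f" "period f 0 (r * a)" "period f g (r * k - g)"
    using assms(1) torus_colorable_def by blast
  \<comment> \<open>The periods wanted for \<open>h\<close> become \<open>(- g * a, g * a)\<close>
    and \<open>(- g * b, r + g * b)\<close> for \<open>f\<close>. Both are integer combinations of
    the given periods; the second uses the relation \<open>1 + b * k = m * a\<close>.\<close>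
  define h where "h = (\<lambda>x y. f (- y) (x + y))"
  have fs: "f (x + 1) (y - 1) \<noteq> f x y" "f (x + 1) y \<noteq> f x y" "f x (y + 1) \<noteq> f x y" "0 \<le> f x y" "f x y < 4" for x y
    using f(1) unfolding lattice_coloring_def by metis+
  have "lattice_coloring h"
    unfolding lattice_coloring_def h_def
  proof (intro allI conjI)
    fix x y
    show "f (- y) (x + y) \<noteq> f (- (y + 1)) (x + (y + 1))"
      using fs(1)[of "- (y + 1)" "x + (y + 1)"] by (simp add: algebra_simps)
    show "f (- y) (x + y) \<noteq> f (- y) (x + 1 + y)"
      using fs(3)[of "- y" "x + y"] by (simp add: algebra_simps)
    show "f (- y) (x + y) \<noteq> f (- (y - 1)) (x + 1 + (y - 1))"
      using fs(2)[of "- y" "x + y"] by (simp add: algebra_simps)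
  qed (use fs in auto)
  moreover have "period h 0 (g * a)"
  proof -
    have "period f (- a * g) (- a * (r * k - g) + k * (r * a))"
      by (rule period_combination[OF f(2,3)])
    then have "period f (- (g * a)) (g * a)"
      by (simp add: algebra_simps)
    then have *: "f (x + - (g * a)) (y + g * a) = f x y" for x y
      unfolding period_def by blast
    show ?thesis
      unfolding period_def h_def
    proof (intro allI)
      fix x y
      show "f (- (y + g * a)) (x + 0 + (y + g * a)) = f (- y) (x + y)"
        using *[of "- y" "x + y"] by (simp add: algebra_simps)
    qed
  qed
  moreover have "period h r (g * b)"
  proof -
    have "period f (- b * g) (- b * (r * k - g) + m * (r * a))"
      by (rule period_combination[OF f(2,3)])
    moreover have "- b * (r * k - g) + m * (r * a) = r + g * b"
    proof -
      have "- b * (r * k - g) + m * (r * a) = r * (m * a) - r * (b * k) + g * b"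
        by (simp add: algebra_simps)
      also have "\<dots> = r + g * b"
        unfolding assms(2)[symmetric] by (simp add: algebra_simps)
      finally show ?thesis .
    qed
    ultimately have "period f (- (g * b)) (r + g * b)"
      by (simp add: algebra_simps)
    then have *: "f (x + - (g * b)) (y + (r + g * b)) = f x y" for x y
      unfolding period_def by blast
    show ?thesis
      unfolding period_def h_def
    proof (intro allI)
      fix x y
      show "f (- (y + g * b)) (x + r + (y + g * b)) = f (- y) (x + y)"
        using *[of "- y" "x + y"] by (simp add: algebra_simps)
    qed
  qed
  ultimately show ?thesis by (rule torus_colorableI)
qed

lemma torus_colorable_rotateI:
  assumes "torus_colorable g (r * a) (r * k - g)" "s = g * a" "t = g * b" "1 + b * k = m * a"
  shows "torus_colorable r s t"
  using torus_colorable_rotate[OF assms(1,4)] assms(2,3) by simp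

section \<open>Constructions\<close>

text \<open>Columns use the color pairs 0, 1 and 2, 3 in turn, so only vertical edges could
  conflict, and \<open>even s\<close> lets each column alternate. The correction
  \<open>t * (x div r)\<close> yields the period \<open>(r, t)\<close> for \<open>t\<close> of
  either parity.\<close>

lemma torus_colorable_even:
  assumes "even r" "even s" "r > 0"
  shows "torus_colorable r s t"
proof (rule torus_colorableI)
  define f :: "int \<Rightarrow> int \<Rightarrow> int" where
    "f = (\<lambda>x y. 2 * (x mod 2) + (y - t * (x div r)) mod 2)"
  show "lattice_coloring f"
    unfolding lattice_coloring_def
  proof (intro allI conjI)
    fix x y
    have b: "0 \<le> z mod 2" "z mod 2 < 2" for z :: int by auto
    show "0 \<le> f x y" "f x y < 4"
      using b[of x] b[of "y - t * (x div r)"] unfolding f_def by linarith+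
    have "(y - t * (x div r)) mod 2 \<noteq> (y + 1 - t * (x div r)) mod 2"
      by presburger
    then show "f x y \<noteq> f x (y + 1)"
      unfolding f_def by simp
    have "x mod 2 = 0 \<and> (x + 1) mod 2 = 1 \<or> x mod 2 = 1 \<and> (x + 1) mod 2 = 0"
      by presburger
    then show "f x y \<noteq> f (x + 1) y" "f x y \<noteq> f (x + 1) (y - 1)"
      using b[of "y - t * (x div r)"] b[of "y - t * ((x + 1) div r)"] b[of "y - 1 - t * ((x + 1) div r)"]
      unfolding f_def by auto
  qed
  show "period f 0 s"
    unfolding period_def f_def
  proof (intro allI)
    fix x y
    have "(y + s - t * (x div r)) mod 2 = (y - t * (x div r)) mod 2"
      using assms(2) by presburger
    then show "2 * ((x + 0) mod 2) + (y + s - t * ((x + 0) div r)) mod 2 = 2 * (x mod 2) + (y - t * (x div r)) mod 2"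
      by simp
  qed
  show "period f r t"
    unfolding period_def f_def
  proof (intro allI)
    fix x y
    have "(x + r) mod 2 = x mod 2"
      using assms(1) by presburger
    then show "2 * ((x + r) mod 2) + (y + t - t * ((x + r) div r)) mod 2 = 2 * (x mod 2) + (y - t * (x div r)) mod 2"
      using assms(3) by (simp add: algebra_simps)
  qed
qed

lemma torus_colorable_three:
  assumes "3 dvd s" "3 dvd r - t"
  shows "torus_colorable r s t"
proof (rule torus_colorableI)
  define f :: "int \<Rightarrow> int \<Rightarrow> int" where "f = (\<lambda>x y. (x - y) mod 3)"
  show "lattice_coloring f"
    unfolding lattice_coloring_def f_def
    by (intro allI conjI; presburger)
  show "period f 0 s" "period f r t"
    using assms unfolding period_def f_def mod_eq_dvd_iff by (simp_all add: algebra_simps)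
qed

section \<open>Colorings built from walks\<close>

text \<open>
  The points \<open>P k x\<close> of column \<open>x\<close> get color 3, and the points between two consecutive ones are
  colored \<open>0, 1, 2\<close> repeatedly.
\<close>
lemma torus_colorable_of_walks:
  fixes P :: "int \<Rightarrow> int \<Rightarrow> int"
  assumes gap: "\<And>k x. P k x + 4 \<le> P (k + 1) x"
    and residue: "\<And>k x. 3 dvd P k x - k - x"
    and walk: "\<And>k x. P k (x + 1) = P k x + 1 \<or> P k (x + 1) = P k x - 2"
    and per1: "\<And>k x. P (k + d) x = P k x + s"
    and per2: "\<And>k x. P (k - e) (x + r) = P k x + t"
  shows "torus_colorable r s t"
proof -
  have lin: "P k x + 4 * int n \<le> P (k + int n) x" for k x n
  proof (induction n)
    case (Suc n)
    then show ?case using gap[of "k + int n" x] by (simp add: algebra_simps)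
  qed simp
  have mono: "P k x + 4 * (l - k) \<le> P l x" if "k \<le> l" for k l x
    using lin[of k x "nat (l - k)"] that by simp
  have mono': "k \<le> l" if "P k x < P (l + 1) x" for k l x
    using that mono[of "l + 1" k x] by (rule_tac ccontr) auto
  have ex: "\<exists>k. P k x \<le> y \<and> y < P (k + 1) x" for x y
  proof -
    define B where "B = \<bar>y\<bar> + \<bar>P 0 x\<bar>"
    have B: "0 \<le> B" "- B \<le> y" "y \<le> B + P 0 x" "P 0 x \<le> B"
      unfolding B_def by linarith+
    define S where "S = {k. k \<ge> - B \<and> P k x \<le> y}"
    have "k \<le> B" if "P k x \<le> y" for k
      using mono[of 0 k x] that B by (cases "0 \<le> k") auto
    then have fin: "finite S"
      by (intro finite_subset[of S "{- B..B}"]) (auto simp: S_def)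
    have "- B \<in> S"
      using mono[of "- B" 0 x] B unfolding S_def by auto
    then have "Max S \<in> S" "Max S + 1 \<notin> S"
      using Max_in[OF fin] Max_ge[OF fin, of "Max S + 1"] by auto
    then obtain M where "M \<in> S" "M + 1 \<notin> S"
      by blast
    then show ?thesis
      unfolding S_def by (intro exI[of _ M]) auto
  qed
  define K where "K x y = (SOME k. P k x \<le> y \<and> y < P (k + 1) x)" for x y
  have K: "P (K x y) x \<le> y" "y < P (K x y + 1) x" for x y
    using someI_ex[OF ex[of x y]] unfolding K_def by auto
  have Keq: "K x y = k" if "P k x \<le> y" "y < P (k + 1) x" for k x y
    using mono'[of k x "K x y"] mono'[of "K x y" x k] K(1)[of x y] K(2)[of y x] that by (auto intro: antisym)
  \<comment> \<open>\<open>P k x\<close> is congruent to \<open>k + x\<close> modulo 3, so the color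
    just above a walk is 0; consecutive walks differ by 1 modulo 3, so the color just below the next
    one is 2.\<close>
  define f where "f x y = (if P (K x y) x = y then 3 else (y - K x y - x - 1) mod 3)" for x y
  have col: "lattice_coloring f"
    unfolding lattice_coloring_def
  proof (intro allI conjI)
    fix x y
    define k where "k = K x y"
    have k: "P k x \<le> y" "y < P (k + 1) x"
      using K unfolding k_def by auto
    show "0 \<le> f x y" "f x y < 4"
      unfolding f_def using pos_mod_bound[of 3 "y - K x y - x - 1"] pos_mod_sign[of 3 "y - K x y - x - 1"]
      by auto
    have lt4: "3 \<noteq> z mod (3::int)" for z by presburger
    show "f x y \<noteq> f x (y + 1)"
    proof (cases "y + 1 = P (k + 1) x")
      case True
      then have "K x (y + 1) = k + 1"
        using gap[of "k + 1" x] by (intro Keq) auto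
      then show ?thesis
        using True gap[of k x] lt4 unfolding f_def k_def[symmetric] by auto
    next
      case False
      then have "K x (y + 1) = k"
        using k by (intro Keq) auto
      moreover have "(y - k - x - 1) mod 3 \<noteq> (y + 1 - k - x - 1) mod 3"
        by presburger
      ultimately show ?thesis
        using k lt4[of "y - k - x - 1"] lt4[of "y + 1 - k - x - 1"] 
        unfolding f_def k_def[symmetric] by (auto split: if_splits)
    qed
    have step: "f x y \<noteq> f (x + 1) z" if z: "z = y \<or> z = y - 1" for z
    proof -
      define l where "l = K (x + 1) z"
      have l: "P l (x + 1) \<le> z" "z < P (l + 1) (x + 1)"
        using K unfolding l_def by auto
      have "k - 1 \<le> l"
        using l mono'[of "k - 1" "x + 1" l] walk[of "k - 1" x] gap[of "k - 1" x] k z by auto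
      moreover have "l \<le> k + 1"
        using l mono'[of l "x + 1" "k + 1"] walk[of "k + 2" x] gap[of "k + 1" x] k z
        by (auto simp: algebra_simps)
      ultimately consider "l = k - 1" | "l = k" | "l = k + 1"
        by linarith
      then have "P k x \<noteq> y \<or> P l (x + 1) \<noteq> z"
        using walk[of l x] gap[of "k - 1" x] gap[of k x] z by cases auto
      \<comment> \<open>Equal residues force \<open>z = y\<close>, \<open>l = k - 1\<close> or
        \<open>z = y - 1\<close>, \<open>l = k + 1\<close>. In the first case walk \<open>k\<close>
        would rise by at least 2, in the second walk \<open>k + 1\<close> would drop by at least
        3.\<close>
      moreover have "P k x = y \<or> P l (x + 1) = z \<or> (y - k - x - 1) mod 3 \<noteq> (z - l - (x + 1) - 1) mod 3"
      proof (rule ccontr)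
        assume H: "\<not> ?thesis"
        from \<open>k - 1 \<le> l\<close> \<open>l \<le> k + 1\<close> have "l = k - 1 \<or> l = k \<or> l = k + 1" by linarith
        moreover have "3 dvd (y - k - x - 1) - (z - l - (x + 1) - 1)"
          using H by (simp only: mod_eq_dvd_iff[symmetric]) simp
        ultimately have "l = k - 1 \<and> z = y \<or> l = k + 1 \<and> z = y - 1"
          using z by (elim disjE) simp_all
        then show False
          using H k l walk[of k x] walk[of "k + 1" x] by auto
      qed
      ultimately show ?thesis
        using lt4[of "y - k - x - 1"] lt4[of "z - l - (x + 1) - 1"]
        unfolding f_def k_def[symmetric] l_def[symmetric] by (auto split: if_splits)
    qed
    show "f x y \<noteq> f (x + 1) y" "f x y \<noteq> f (x + 1) (y - 1)"
      by (rule step; simp)+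
  qed
  \<comment> \<open>A translation that carries walks to walks with indices shifted by
    \<open>c\<close> preserves the color formula, because \<open>residue\<close> forces
    \<open>b\<close> to be congruent to \<open>a + c\<close> modulo 3.\<close>
  have per: "period f a b" if P: "\<And>k x. P (k + c) (x + a) = P k x + b" for a b c
    unfolding period_def
  proof (intro allI)
    fix x y
    have "K (x + a) (y + b) = K x y + c"
      using P[of "K x y" x] P[of "K x y + 1" x] K(1)[of x y] K(2)[of y x]
      by (intro Keq) (auto simp: algebra_simps)
    moreover have "(y + b - (K x y + c) - (x + a) - 1) mod 3 = (y - K x y - x - 1) mod 3"
    proof -
      have "3 dvd b - c - a"
        using dvd_diff[OF residue[of c a] residue[of 0 0]] P[of 0 0] by (simp add: algebra_simps)
      then show ?thesis
        unfolding mod_eq_dvd_iff by (simp add: algebra_simps)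
    qed
    ultimately show "f (x + a) (y + b) = f x y"
      unfolding f_def using P[of "K x y" x] by auto
  qed
  have "period f 0 s"
    by (rule per[of d]) (simp add: per1)
  moreover have "period f r t"
    by (rule per[of "- e"]) (use per2 in simp)
  ultimately show ?thesis
    by (rule torus_colorableI[OF col])
qed

text \<open>
  There are \<open>d\<close> walks per period \<open>s\<close>, each of which makes a proportion \<open>W / (d * r)\<close> of its steps
  downwards, where \<open>W = E * d - e * N\<close>; the walk with index \<open>k\<close> is continued by the one with index
  \<open>k - e\<close> after \<open>r\<close> columns.
\<close>
lemma torus_colorable_slope:
  assumes r: "r \<ge> 1" and s: "s = 3 * N + d" and t: "r - t = 3 * E + e"
    and d: "0 < d" "d \<le> N" and W: "0 \<le> E * d - e * N" "E * d - e * N \<le> r * d"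
  shows "torus_colorable r s t"
proof -
  define W where "W = E * d - e * N"
  define m where "m = d * r"
  \<comment> \<open>This is \<open>k * N / d - x * W / (d * r)\<close> rounded down. The bounds on
    \<open>W\<close> make it fall by 0 or 1 per column, so that \<open>k + x + 3 * F k x\<close>
    moves by \<open>+1\<close> or \<open>-2\<close>; \<open>d \<le> N\<close> makes it grow by at
    least 1 with \<open>k\<close>, which gives the gap of 4.\<close>
  define F where "F k x = (k * N * r - x * W) div m" for k x
  have m: "m > 0" using r d(1) by (simp add: m_def)
  have Nr: "N * r \<ge> m" using r d(2) by (simp add: m_def mult_right_mono)
  have W0: "0 \<le> W" "W \<le> m" using W by (simp_all add: W_def m_def mult.commute)
  have shift: "(a + m * c) div m = a div m + c" for a c
    using m by simp
  show ?thesis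
  proof (rule torus_colorable_of_walks)
    fix k x
    let ?P = "\<lambda>k x. k + x + 3 * F k x"
    have "F k x + 1 = (k * N * r - x * W + m * 1) div m"
      unfolding F_def shift ..
    also have "\<dots> \<le> F (k + 1) x"
      unfolding F_def using m Nr by (intro zdiv_mono1) (auto simp: algebra_simps)
    finally show "?P k x + 4 \<le> ?P (k + 1) x" by simp
    show "3 dvd ?P k x - k - x" by simp
    have "F k (x + 1) \<le> F k x"
      unfolding F_def using m W0 by (intro zdiv_mono1) (auto simp: algebra_simps)
    moreover have "F k x - 1 \<le> F k (x + 1)"
    proof -
      have "F k x - 1 = (k * N * r - x * W + m * (-1)) div m"
        unfolding F_def shift by simp
      also have "\<dots> \<le> F k (x + 1)"
        unfolding F_def using m W0 by (intro zdiv_mono1) (auto simp: algebra_simps)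
      finally show ?thesis .
    qed
    ultimately have "F k (x + 1) = F k x \<or> F k (x + 1) = F k x - 1"
      by linarith
    then show "?P k (x + 1) = ?P k x + 1 \<or> ?P k (x + 1) = ?P k x - 2"
      by auto
    have "(k + d) * N * r - x * W = k * N * r - x * W + m * N"
      by (simp add: m_def algebra_simps)
    then have "F (k + d) x = F k x + N"
      unfolding F_def by (simp only: shift)
    then show "?P (k + d) x = ?P k x + s"
      using s by simp
    have "(k - e) * N * r - (x + r) * W = k * N * r - x * W + m * (- E)"
      by (simp add: m_def W_def algebra_simps)
    then have "F (k - e) (x + r) = F k x - E"
      unfolding F_def by (simp only: shift)
    then show "?P (k - e) (x + r) = ?P k x + t"
      using t by simp
  qed
qed

text \<open>Multiplying \<open>W\<close> by 3 eliminates \<open>N\<close> and \<open>E\<close>, so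
  that for a concrete torus only \<open>d\<close> and \<open>e\<close> have to be chosen.\<close>

lemma torus_colorable_slope_dvd:
  assumes "r \<ge> 1" "3 dvd s - d" "3 dvd r - t - e" "0 < d" "4 * d \<le> s"
    and "0 \<le> (r - t) * d - e * s" "(r - t) * d - e * s \<le> 3 * r * d"
  shows "torus_colorable r s t"
proof -
  obtain N E where N: "s = 3 * N + d" and E: "r - t = 3 * E + e"
    using assms(2,3) by (metis dvdE diff_add_cancel)
  have "(r - t) * d - e * s = 3 * (E * d - e * N)"
    unfolding N E by (simp add: algebra_simps)
  then show ?thesis
    using assms(4-) N by (intro torus_colorable_slope[OF assms(1) N E]) auto
qed

text \<open>Replacing \<open>e\<close> by \<open>e + 3 * f\<close> and \<open>E\<close> by
  \<open>E - f\<close> lowers \<open>W\<close> by \<open>f * s\<close>. Hence \<open>W\<close> can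
  be reduced modulo \<open>s\<close>, and the interval from 0 to \<open>r * d\<close> contains all
  remainders.\<close>

lemma torus_colorable_wide:
  assumes "r \<ge> 1" "3 dvd s - d" "0 < d" "4 * d \<le> s" "s - 1 \<le> r * d"
  shows "torus_colorable r s t"
proof -
  obtain N where N: "s = 3 * N + d"
    using assms(2) by (metis dvdE diff_add_cancel)
  define e where "e = (r - t) mod 3"
  define E where "E = (r - t) div 3"
  define f where "f = (E * d - e * N) div s"
  have s: "s > 0" using assms by linarith
  have "(E - f) * d - (e + 3 * f) * N = (E * d - e * N) - f * s"
    unfolding N by (simp add: algebra_simps)
  also have "\<dots> = (E * d - e * N) mod s"
    by (simp add: f_def minus_div_mult_eq_mod)
  finally have V: "(E - f) * d - (e + 3 * f) * N = (E * d - e * N) mod s" .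
  show ?thesis
  proof (rule torus_colorable_slope[OF assms(1) N])
    show "r - t = 3 * (E - f) + (e + 3 * f)"
      by (simp add: E_def e_def)
    show "0 \<le> (E - f) * d - (e + 3 * f) * N" "(E - f) * d - (e + 3 * f) * N \<le> r * d"
      unfolding V using pos_mod_bound[OF s, of "E * d - e * N"] pos_mod_sign[OF s, of "E * d - e * N"] assms(5)
      by linarith+
  qed (use assms N in auto)
qed

text \<open>With \<open>N = d\<close> the walks are exactly 4 apart. Then \<open>W = j * d\<close>,
  where \<open>j\<close> is determined only modulo 4, so three columns suffice.\<close>

lemma torus_colorable_4_dvd:
  assumes "r \<ge> 3" "4 dvd s" "s > 0"
  shows "torus_colorable r s t"
proof -
  obtain q where q: "s = 4 * q" using assms(2) by blast
  define j where "j = (t - r) mod 4"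
  have "4 dvd r - t - 3 * j" unfolding j_def by presburger
  then obtain e where e: "r - t - 3 * j = 4 * e" by blast
  have j: "0 \<le> j" "j \<le> r" using assms(1) by (auto simp: j_def intro: order_trans[of _ 3])
  show ?thesis
  proof (rule torus_colorable_slope[where N = q and d = q and E = "e + j" and e = e])
    show "(e + j) * q - e * q \<le> r * q" "0 \<le> (e + j) * q - e * q"
      using j q assms(3) by (auto simp: algebra_simps mult_left_mono)
  qed (use assms q e in auto)
qed

text \<open>All three directions have circuits of length 5, and no \<open>d > 0\<close> satisfies
  both \<open>3 dvd 5 - d\<close> and \<open>4 * d \<le> 5\<close>. The list \<open>M\<close> gives
  the colors column by column; the check is over pairs of residues.\<close>

lemma torus_colorable_5_5_0: "torus_colorable 5 5 0"
proof (rule torus_colorableI)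
  define M :: "int list list" where
    "M = [[0, 1, 0, 1, 2], [2, 3, 2, 0, 1], [0, 1, 3, 2, 3], [2, 0, 1, 0, 1], [1, 2, 3, 2, 0]]"
  define f where "f x y = M ! nat (x mod 5) ! nat (y mod 5)" for x y :: int
  have step: "(z + 1) mod 5 = (z mod 5 + 1) mod 5" "(z - 1) mod 5 = (z mod 5 - 1) mod 5" for z :: int
    by presburger+
  have res: "z mod 5 = 0 \<or> z mod 5 = 1 \<or> z mod 5 = 2 \<or> z mod 5 = 3 \<or> z mod 5 = 4" for z :: int
    by presburger
  show "lattice_coloring f"
    unfolding lattice_coloring_def
  proof (intro allI)
    fix x y
    have "0 \<le> M ! nat (x mod 5) ! nat (y mod 5) \<and> M ! nat (x mod 5) ! nat (y mod 5) < 4 \<and>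
       M ! nat (x mod 5) ! nat (y mod 5) \<noteq> M ! nat (x mod 5) ! nat ((y mod 5 + 1) mod 5) \<and>
       M ! nat (x mod 5) ! nat (y mod 5) \<noteq> M ! nat ((x mod 5 + 1) mod 5) ! nat (y mod 5) \<and>
       M ! nat (x mod 5) ! nat (y mod 5) \<noteq> M ! nat ((x mod 5 + 1) mod 5) ! nat ((y mod 5 - 1) mod 5)"
      using res[of x] res[of y] by (elim disjE) (simp_all add: M_def)
    then show "0 \<le> f x y \<and> f x y < 4 \<and> f x y \<noteq> f x (y + 1) \<and> f x y \<noteq> f (x + 1) y \<and> f x y \<noteq> f (x + 1) (y - 1)"
      unfolding f_def step(1)[of x] step[of y] .
  qed
  show "period f 0 5" "period f 5 0"
    by (simp_all add: period_def f_def)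
qed

section \<open>The arithmetic of the three circuit counts\<close>

text \<open>The two gcds in the conclusion count the circuits of the rotated torus.\<close>
lemma gcd_rotate:
  fixes r s t g :: int
  assumes "r > 0" "g > 0" "s = g * a" "t = g * b" "1 + b * k = m * a"
  shows "gcd (r * a) (r * k - g) = gcd s (r + t)" "gcd (r * a) (g + (r * k - g)) = r"
proof -
  \<comment> \<open>The pairs \<open>s\<close>, \<open>r + t\<close> and \<open>r * a\<close>,
    \<open>r * k - g\<close> are integer combinations of each other, hence have the same common
    divisors.\<close>
  have s: "s = k * (r * a) - a * (r * k - g)"
    unfolding assms by (simp add: algebra_simps)
  have rt: "r + t = m * (r * a) - b * (r * k - g)"
  proof -
    have "m * (r * a) - b * (r * k - g) = r * (m * a) - r * (b * k) + t"
      unfolding assms(4) by (simp add: algebra_simps)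
    also have "\<dots> = r + t"
      unfolding assms(5)[symmetric] by (simp add: algebra_simps)
    finally show ?thesis ..
  qed
  have ra: "r * a = a * (r + t) - b * s"
    unfolding assms by (simp add: algebra_simps)
  have rk: "r * k - g = k * (r + t) - m * s"
  proof -
    have "k * (r + t) - m * s = k * r + g * (b * k) - g * (m * a)"
      unfolding assms(3,4) by (simp add: algebra_simps)
    also have "\<dots> = r * k - g"
      unfolding assms(5)[symmetric] by (simp add: algebra_simps)
    finally show ?thesis ..
  qed
  show "gcd (r * a) (r * k - g) = gcd s (r + t)"
  proof (rule zdvd_antisym_nonneg)
    have comb: "c dvd p * x - q * y" if "c dvd x" "c dvd y" for c p q x y :: int
      using that by (intro dvd_diff dvd_mult)
    have "c dvd s \<and> c dvd r + t" if "c dvd r * a" "c dvd r * k - g" for c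
      using comb[OF that, of k a] comb[OF that, of m b] by (simp only: s[symmetric] rt[symmetric])
    from this[OF gcd_dvd1 gcd_dvd2] show "gcd (r * a) (r * k - g) dvd gcd s (r + t)"
      by (simp only: gcd_greatest_iff)
    have "c dvd r * a \<and> c dvd r * k - g" if "c dvd s" "c dvd r + t" for c
      using comb[OF that(2,1), of a b] comb[OF that(2,1), of k m] by (simp only: ra[symmetric] rk[symmetric])
    from this[OF gcd_dvd1 gcd_dvd2] show "gcd s (r + t) dvd gcd (r * a) (r * k - g)"
      by (simp only: gcd_greatest_iff)
  qed auto
  \<comment> \<open>The second gcd is that of \<open>r * a\<close> and \<open>r * k\<close>.\<close>
  have "coprime a k"
  proof (rule coprimeI)
    fix c assume "c dvd a" "c dvd k"
    then have "c dvd m * a - b * k" by (intro dvd_diff dvd_mult)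
    moreover have "m * a - b * k = 1" using assms(5) by linarith
    ultimately show "is_unit c" by simp
  qed
  then show "gcd (r * a) (g + (r * k - g)) = r"
    using assms(1) by (simp add: gcd_mult_distrib_int[symmetric])
qed

text \<open>Supplies the parameters of \<open>torus_colorable_rotate\<close>: division by
  \<open>g\<close> leaves coprime numbers, and Bezout's identity gives \<open>k\<close> and
  \<open>m\<close>.\<close>

lemma rotation_witness:
  fixes s t :: int
  assumes "s > 0" "g = gcd s t"
  obtains a b k m where "s = g * a" "t = g * b" "1 + b * k = m * a" "g > 0" "a > 0"
proof -
  have g: "g > 0" using assms by simp
  obtain a b where ab: "s = g * a" "t = g * b"
    using assms(2) by (metis dvdE gcd_dvd1 gcd_dvd2)
  have "gcd (g * a) (g * b) = g * gcd a b"
    using g by (simp add: gcd_mult_distrib_int[symmetric])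
  then have "g = g * gcd a b"
    using assms(2) ab by metis
  then have "gcd a b = 1" using g by simp
  then obtain u v where "u * a + v * b = 1"
    using bezout_int[of a b] by auto
  then have "1 + b * (- v) = u * a" by (simp add: algebra_simps)
  moreover have "a > 0" using assms(1) ab g by (simp add: zero_less_mult_iff)
  ultimately show ?thesis using that ab g by blast
qed

section \<open>Tori with columns of length 3, 5, 6 or 9\<close>

text \<open>The rotation with \<open>a = 1\<close>: short columns of length \<open>s\<close> are
  traded for columns of length \<open>r\<close>, where walks have more room.\<close>

lemma torus_colorable_swap:
  assumes "torus_colorable s r (- s)" "s dvd t"
  shows "torus_colorable r s t"
proof -
  obtain b where "t = s * b" using assms(2) by blast
  then show ?thesis
    using assms(1) by (rule_tac torus_colorable_rotateI[where g = s and a = 1 and b = b and k = 0 and m = 1]) auto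
qed

lemma torus_colorable_length_3:
  assumes "r \<ge> 4" "3 dvd t"
  shows "torus_colorable r 3 t"
proof -
  have "r mod 3 = 0 \<or> r mod 3 = 1 \<or> r = 5 \<or> r mod 3 = 2 \<and> r \<ge> 8"
    using assms(1) by presburger
  then consider "r mod 3 = 0" | "r mod 3 = 1" | "r = 5" | "r mod 3 = 2" "r \<ge> 8"
    by blast
  then show ?thesis
  proof cases
    case 1
    then show ?thesis
      using assms by (intro torus_colorable_three) auto
  next
    case 2
    then have "3 dvd r - 1" by presburger
    then have "torus_colorable 3 r (- 3)"
      using assms by (intro torus_colorable_slope_dvd[where d = 1 and e = 0]) auto
    then show ?thesis using assms by (rule_tac torus_colorable_swap)
  next
    case 3
    \<comment> \<open>Two walks do not fit into length 5. As 3 and 5 are coprime, there is a single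
      diagonal circuit, of length 15, and it serves as the only column.\<close>
    have "torus_colorable 1 15 9"
      by (rule torus_colorable_slope_dvd[where d = 3 and e = "- 2"]) auto
    then have "torus_colorable 5 3 (- 5 - 0)"
      by (rule_tac torus_colorable_rotateI[where g = 1 and a = 3 and b = "- 5" and k = 2 and m = "- 3"]) auto
    then show ?thesis
      using 3 assms(2) by (intro torus_colorable_modI[of t 3 0 r] torus_colorable_mirror[of r 3 0]) auto
  next
    case 4
    then have "3 dvd r - 2" by presburger
    then have "torus_colorable 3 r (- 3)"
      using 4 by (intro torus_colorable_slope_dvd[where d = 2 and e = 0]) auto
    then show ?thesis using assms by (rule_tac torus_colorable_swap)
  qed
qed

text \<open>After the swap, walks with \<open>e = 1\<close> close up if
  \<open>4 * d \<le> r \<le> 10 * d\<close>. The largest \<open>d\<close> congruent to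
  \<open>r\<close> modulo 3 with \<open>4 * d \<le> r\<close> is \<open>q\<close>,
  \<open>q - 1\<close> or \<open>q - 2\<close>, which fails for \<open>r\<close> equal to 5, 6, 9
  and 13. The last three are coprime to 5, so their single diagonal circuit is used instead.\<close>

lemma torus_colorable_length_5:
  assumes "r \<ge> 5" "5 dvd t" "\<not> 4 dvd r"
  shows "torus_colorable r 5 t"
proof -
  have sl: "torus_colorable r 5 t" if "3 dvd r - d" "0 < d" "4 * d \<le> r" "r \<le> 10 * d" for d
  proof -
    have "torus_colorable 5 r (- 5)"
      using that by (intro torus_colorable_slope_dvd[where d = d and e = 1]) auto
    then show ?thesis using assms by (rule_tac torus_colorable_swap)
  qed
  have t0: "torus_colorable r 5 t" if "torus_colorable r 5 (- r - 0)"
    using that assms by (intro torus_colorable_modI[of t 5 0 r] torus_colorable_mirror[of r 5 0]) auto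
  define q where "q = r div 4"
  have "r = 4 * q + r mod 4" "0 \<le> r mod 4" "r mod 4 < 4" "r mod 4 \<noteq> 0"
    using assms(3) by (auto simp: q_def dvd_eq_mod_eq_0)
  then have "r = 4 * q + 1 \<or> r = 4 * q + 2 \<or> r = 4 * q + 3"
    by linarith
  moreover have "q \<ge> 1" if "r = 4 * q + 3" using that assms(1) by simp
  moreover have "q = 1 \<or> q \<ge> 2" if "r = 4 * q + 2" using that assms(1) by linarith
  moreover have "q = 1 \<or> q = 2 \<or> q = 3 \<or> q \<ge> 4" if "r = 4 * q + 1" using that assms(1) by linarith
  ultimately have "r = 5 \<or> r = 6 \<or> r = 9 \<or> r = 13 \<or> r = 4 * q + 3 \<and> q \<ge> 1 \<or>
      r = 4 * q + 2 \<and> q \<ge> 2 \<or> r = 4 * q + 1 \<and> q \<ge> 4"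
    by auto
  then consider "r = 5" | "r = 6" | "r = 9" | "r = 13"
    | "r = 4 * q + 3" "q \<ge> 1" | "r = 4 * q + 2" "q \<ge> 2" | "r = 4 * q + 1" "q \<ge> 4"
    by blast
  then show ?thesis
  proof cases
    case 1
    then show ?thesis
      using assms torus_colorable_5_5_0 by (intro torus_colorable_modI[of t 5 0 r]) auto
  next
    case 2
    have "torus_colorable 1 30 5"
      by (rule torus_colorable_slope_dvd[where d = 6 and e = "- 1"]) auto
    then have "torus_colorable r 5 (- r - 0)" using 2
      by (rule_tac torus_colorable_rotateI[where g = 1 and a = 5 and b = "- 6" and k = 1 and m = "- 1"]) auto
    then show ?thesis by (rule t0)
  next
    case 3
    have "torus_colorable 1 45 35"
      by (rule torus_colorable_slope_dvd[where d = 9 and e = "- 7"]) auto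
    then have "torus_colorable r 5 (- r - 0)" using 3
      by (rule_tac torus_colorable_rotateI[where g = 1 and a = 5 and b = "- 9" and k = 4 and m = "- 7"]) auto
    then show ?thesis by (rule t0)
  next
    case 4
    have "torus_colorable 1 65 25"
      by (rule torus_colorable_slope_dvd[where d = 8 and e = "- 3"]) auto
    then have "torus_colorable r 5 (- r - 0)" using 4
      by (rule_tac torus_colorable_rotateI[where g = 1 and a = 5 and b = "- 13" and k = 2 and m = "- 5"]) auto
    then show ?thesis by (rule t0)
  next
    case 5
    then show ?thesis by (intro sl[of q]) auto
  next
    case 6
    then show ?thesis by (intro sl[of "q - 1"]) auto
  next
    case 7
    then show ?thesis by (intro sl[of "q - 2"]) auto
  qed
qed

text \<open>If 3 does not divide \<open>r\<close>, rotation gives columns of length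
  \<open>r * a\<close> with \<open>a = 6 / gcd 6 t\<close>. There \<open>d = a * (r mod 3)\<close>
  walks work, except when they do not fit, which happens only for \<open>r = 5\<close>.\<close>

lemma torus_colorable_length_6:
  assumes "r \<ge> 5" "3 dvd t" "6 dvd t \<Longrightarrow> r \<ge> 6"
  shows "torus_colorable r 6 t"
proof (cases "3 dvd r")
  case True
  then show ?thesis
    using assms by (intro torus_colorable_three) auto
next
  case False
  then have "r mod 3 = 1 \<or> r mod 3 = 2 \<and> r = 5 \<or> r mod 3 = 2 \<and> r \<ge> 8"
    using assms(1) by presburger
  then consider "r mod 3 = 1" | "r mod 3 = 2" "r = 5" | "r mod 3 = 2" "r \<ge> 8"
    by blast
  note r_cases = this
  show ?thesis
  proof (cases "6 dvd t")
    case True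
    have "torus_colorable 6 r (- 6)"
      using r_cases
    proof cases
      case 1
      then have "3 dvd r - 1" by presburger
      then show ?thesis
        using assms by (intro torus_colorable_slope_dvd[where d = 1 and e = 0]) auto
    next
      case 3
      then have "3 dvd r - 2" by presburger
      then show ?thesis
        using 3 by (intro torus_colorable_slope_dvd[where d = 2 and e = 0]) auto
    qed (use True assms in auto)
    then show ?thesis using True by (rule torus_colorable_swap)
  next
    case False
    obtain b where b: "t = 3 * b" using assms(2) by blast
    have "odd b" using False b by presburger
    then obtain m where m: "1 + b = 2 * m" by (metis dvdE odd_even_add odd_one)
    have rot: "torus_colorable r 6 t" if "torus_colorable 3 (2 * r) (r - 3)"
      using that b m
      by (rule_tac torus_colorable_rotateI[where g = 3 and a = 2 and b = b and k = 1 and m = m])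
        (auto simp: mult.commute)
    from r_cases show ?thesis
    proof cases
      case 1
      then have "3 dvd 2 * r - 2" "3 dvd 3 - (r - 3) + 1" by presburger+
      then show ?thesis
        using assms by (intro rot torus_colorable_slope_dvd[where d = 2 and e = "- 1"]) auto
    next
      case 2
      \<comment> \<open>Here \<open>gcd 6 (5 + t) = 2\<close>, and the two diagonal circuits of
        length 15 serve as columns.\<close>
      have "torus_colorable 2 15 3"
        by (rule torus_colorable_slope_dvd[where d = 3 and e = "- 1"]) auto
      then have "torus_colorable r 6 (- r - 3)" using 2
        by (rule_tac torus_colorable_rotateI[where g = 2 and a = 3 and b = "- 4" and k = 1 and m = "- 1"]) auto
      moreover have "t mod 6 = 3" using assms(2) False by presburger
      ultimately show ?thesis
        using torus_colorable_mirror torus_colorable_modI by blast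
    next
      case 3
      then have "3 dvd 2 * r - 4" "3 dvd 3 - (r - 3) + 2" by presburger+
      then show ?thesis
        using 3 by (intro rot torus_colorable_slope_dvd[where d = 4 and e = "- 2"]) auto
    qed
  qed
qed

text \<open>The choice \<open>d = a * (r mod 3)\<close> is as for length 6, now with
  \<open>a = 9 / gcd 9 t\<close>; again \<open>r = 5\<close> is separate.\<close>

lemma torus_colorable_length_9:
  assumes "r \<ge> 5" "3 dvd t" "9 dvd t \<Longrightarrow> r \<ge> 9"
  shows "torus_colorable r 9 t"
proof (cases "3 dvd r")
  case True
  then show ?thesis
    using assms by (intro torus_colorable_three) auto
next
  case False
  then have "r mod 3 = 1 \<or> r mod 3 = 2 \<and> r = 5 \<or> r mod 3 = 2 \<and> r \<ge> 8"
    using assms(1) by presburger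
  then consider "r mod 3 = 1" | "r mod 3 = 2" "r = 5" | "r mod 3 = 2" "r \<ge> 8"
    by blast
  note r_cases = this
  have "t mod 9 = 0 \<or> t mod 9 = 3 \<or> t mod 9 = 6"
    using assms(2) by presburger
  then consider "t mod 9 = 0" | "t mod 9 = 3" | "t mod 9 = 6"
    by blast
  then show ?thesis
  proof cases
    case 1
    then have t: "9 dvd t" by presburger
    have "torus_colorable 9 r (- 9)"
      using r_cases
    proof cases
      case 1
      then have "3 dvd r - 1" by presburger
      then show ?thesis
        using assms by (intro torus_colorable_slope_dvd[where d = 1 and e = 0]) auto
    next
      case 3
      then have "3 dvd r - 2" by presburger
      then show ?thesis
        using 3 by (intro torus_colorable_slope_dvd[where d = 2 and e = 0]) auto
    qed (use t assms in auto)
    then show ?thesis using t by (rule torus_colorable_swap)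
  next
    case 2
    have rot: "torus_colorable r 9 t" if "torus_colorable 3 (3 * r) (- r - 3)"
    proof (rule torus_colorable_modI[OF 2])
      show "torus_colorable r 9 3"
        using that
        by (rule_tac torus_colorable_rotateI[where g = 3 and a = 3 and b = 1 and k = "- 1" and m = 0])
          (auto simp: mult.commute)
    qed
    from r_cases show ?thesis
    proof cases
      case 1
      then have "3 dvd 3 * r - 3" "3 dvd 3 - (- r - 3) - 1" by presburger+
      then show ?thesis
        using assms by (intro rot torus_colorable_slope_dvd[where d = 3 and e = 1]) auto
    next
      case r5: 2
      \<comment> \<open>Six walks do not fit into length 15, but three do. Taking
        \<open>k = 2\<close> instead of \<open>- 1\<close> only changes the shift from
        \<open>- 8\<close> to 7, its residue modulo 15.\<close>
      have "torus_colorable 3 15 7"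
        by (rule torus_colorable_slope_dvd[where d = 3 and e = "- 1"]) auto
      then have "torus_colorable r 9 3" using r5
        by (rule_tac torus_colorable_rotateI[where g = 3 and a = 3 and b = 1 and k = 2 and m = 1]) auto
      then show ?thesis by (rule torus_colorable_modI[OF 2])
    next
      case 3
      then have "3 dvd 3 * r - 6" "3 dvd 3 - (- r - 3) - 2" by presburger+
      then show ?thesis
        using 3 by (intro rot torus_colorable_slope_dvd[where d = 6 and e = 2]) auto
    qed
  next
    case t: 3
    have rot: "torus_colorable r 9 t" if "torus_colorable 3 (3 * r) (r - 3)"
    proof (rule torus_colorable_modI[OF t])
      show "torus_colorable r 9 6"
        using that
        by (rule_tac torus_colorable_rotateI[where g = 3 and a = 3 and b = 2 and k = 1 and m = 1])
          (auto simp: mult.commute)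
    qed
    from r_cases show ?thesis
    proof cases
      case 1
      then have "3 dvd 3 * r - 3" "3 dvd 3 - (r - 3) + 1" by presburger+
      then show ?thesis
        using assms by (intro rot torus_colorable_slope_dvd[where d = 3 and e = "- 1"]) auto
    next
      case 2
      \<comment> \<open>As \<open>gcd 9 (5 + 6) = 1\<close>, the single diagonal circuit of length
        45 serves as the column.\<close>
      have "torus_colorable 1 45 24"
        by (rule torus_colorable_slope_dvd[where d = 9 and e = "- 5"]) auto
      then have "torus_colorable r 9 (- r - 6)" using 2
        by (rule_tac torus_colorable_rotateI[where g = 1 and a = 9 and b = "- 11" and k = 5 and m = "- 6"]) auto
      then show ?thesis
        by (rule torus_colorable_modI[OF t torus_colorable_mirror])
    next
      case 3
      then have "3 dvd 3 * r - 6" "3 dvd 3 - (r - 3) + 2" by presburger+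
      then show ?thesis
        using 3 by (intro rot torus_colorable_slope_dvd[where d = 6 and e = "- 2"]) auto
    qed
  qed
qed

section \<open>Case analysis when no count exceeds the number of columns\<close>

text \<open>In the main cases \<open>torus_colorable_wide\<close> is applied with the largest
  \<open>d\<close> such that \<open>4 * d \<le> s\<close> and \<open>3 dvd s - d\<close>, namely
  \<open>q\<close>, \<open>q - 1\<close> or \<open>q - 2\<close> according to \<open>s\<close>
  modulo 4. Where \<open>s - 1 \<le> r * d\<close> fails, \<open>g dvd s\<close> and the bounds on
  both gcds leave few residues of \<open>t\<close>.\<close>

lemma torus_colorable_max_column_aux:
  assumes r: "r \<ge> 1" and s: "s \<ge> 1"
    and g: "g = gcd s t" "g \<ge> 3" "g \<le> r" and h: "gcd s (r + t) \<le> r"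
  shows "torus_colorable r s t"
proof -
  have "gcd s t > 0" "gcd s (r + t) > 0"
    using s by auto
  then have maxg: "c dvd s \<Longrightarrow> c dvd t \<Longrightarrow> c \<le> r"
    and maxh: "c dvd s \<Longrightarrow> c dvd r + t \<Longrightarrow> c \<le> r" for c
    using zdvd_imp_le[OF gcd_greatest[of c s t]] zdvd_imp_le[OF gcd_greatest[of c s "r + t"]] g h by auto
  have gs: "g dvd s" and gt: "g dvd t"
    using g(1) by auto
  show ?thesis
  proof (cases "even r \<and> even s \<or> 4 dvd s \<or> 4 dvd r \<or> 3 dvd s \<and> 3 dvd r - t \<or> r \<le> 4")
    case True
    moreover have "r = 3 \<or> 4 dvd r" if "r \<le> 4"
      using that g by (cases "r = 4") auto
    ultimately consider "even r" "even s" | "4 dvd s" | "4 dvd r" | "3 dvd s" "3 dvd r - t" | "r = 3"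
      by blast
    then show ?thesis
    proof cases
      case 1
      then show ?thesis using r by (intro torus_colorable_even) auto
    next
      case 2
      then show ?thesis using g s by (intro torus_colorable_4_dvd) auto
    next
      case 3
      have "s > 0" using s by simp
      obtain a b k m where *: "s = g * a" "t = g * b" "1 + b * k = m * a" "a > 0"
        by (rule rotation_witness[OF \<open>s > 0\<close> g(1)])
      \<comment> \<open>The rotated columns have length \<open>r * a\<close>, which inherits the
        factor 4 from \<open>r\<close>.\<close>
      have "torus_colorable g (r * a) (r * k - g)"
        using 3 g *(4) r by (intro torus_colorable_4_dvd) auto
      then show ?thesis using * by (rule_tac torus_colorable_rotateI)
    next
      case 4
      then show ?thesis by (intro torus_colorable_three)
    next
      case 5
      then have "g = 3" using g by simp
      then show ?thesis
        using 5 gs gt by (intro torus_colorable_three) auto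
    qed
  next
    case False
    then have easy: "odd r \<or> odd s" "\<not> 4 dvd s" "\<not> 4 dvd r" "\<not> (3 dvd s \<and> 3 dvd r - t)" "r \<ge> 5"
      by auto
    have wide: "torus_colorable r s t" if "3 dvd s - d" "0 < d" "4 * d \<le> s" "s - 1 \<le> r * d" for d
      using that r by (intro torus_colorable_wide)
    define q where "q = s div 4"
    have "s = 4 * q + s mod 4" "0 \<le> s mod 4" "s mod 4 < 4" "s mod 4 \<noteq> 0"
      using easy(2) by (auto simp: q_def dvd_eq_mod_eq_0)
    then have "s = 4 * q + 3 \<or> s = 4 * q + 2 \<or> s = 4 * q + 1"
      by linarith
    then show ?thesis
    proof (elim disjE)
      assume sq: "s = 4 * q + 3"
      show ?thesis
      proof (cases "q = 0 \<or> q = 1 \<and> r = 5")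
        case True
        then show ?thesis
        proof
          assume "q = 0"
          then have "s = 3" using sq by simp
          moreover have "g = 3"
            using zdvd_imp_le[OF gs] g(2) s \<open>s = 3\<close> by simp
          ultimately show ?thesis
            using torus_colorable_length_3[of r t] easy gt by simp
        next
          assume "q = 1 \<and> r = 5"
          then have "g dvd 7" "g = 3 \<or> g = 4 \<or> g = 5" using gs sq g by auto
          then show ?thesis by auto
        qed
      next
        case False
        have "q \<ge> 0" using s sq by linarith
        then have q: "q \<ge> 1" "r = 5 \<Longrightarrow> q \<ge> 2" using False by auto
        have "4 * q + 2 \<le> r * q"
        proof (cases "r = 5")
          case r6: False
          have "6 * q \<le> r * q"
            using easy r6 q by (intro mult_right_mono) auto
          then show ?thesis using q by linarith
        qed (use q in auto)
        then show ?thesis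
          using sq q by (intro wide[of q]) auto
      qed
    next
      assume sq: "s = 4 * q + 2"
      then have odd: "odd r" using easy by auto
      show ?thesis
      proof (cases "q \<le> 1 \<or> r = 5 \<and> q \<le> 5 \<or> r = 7 \<and> q = 2")
        case True
        then have "q = 0 \<or> q = 1 \<or> r = 5 \<and> q = 2 \<or> r = 5 \<and> q = 3 \<or> r = 5 \<and> q = 4 \<or> r = 5 \<and> q = 5 \<or> r = 7 \<and> q = 2"
          using s sq by auto
        then show ?thesis
        proof (elim disjE conjE)
          assume "q = 0"
          then have "g \<le> 2" using zdvd_imp_le[OF gs] s sq by simp
          then show ?thesis using g by simp
        next
          assume "q = 1"
          then have s6: "s = 6" using sq by simp
          have "g \<le> 6" using zdvd_imp_le[OF gs] s6 by simp
          then have "g = 3 \<or> g = 4 \<or> g = 5 \<or> g = 6" using g by auto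
          then have "3 dvd g" using gs s6 by auto
          then have "3 dvd t" using gt by (rule dvd_trans)
          then show ?thesis
            using torus_colorable_length_6[of r t] maxg[of 6] s6 easy by simp
        next
          assume q: "r = 5" "q = 2"
          then have "g = 3 \<or> g = 4 \<or> g = 5" using g by auto
          then have "5 dvd t" using gs gt q sq by auto
          \<comment> \<open>This case is void: \<open>t\<close> is 0 or 5 modulo 10, and one of the
            gcds would be 10.\<close>
          moreover have "\<not> 10 dvd t" "\<not> 10 dvd 5 + t"
            using maxg[of 10] maxh[of 10] q sq by auto
          ultimately show ?thesis by presburger
        next
          assume q: "r = 5" "q = 3"
          then have "g = 3 \<or> g = 4 \<or> g = 5" using g by auto
          then show ?thesis using gs q sq by auto
        next
          assume q: "r = 5" "q = 4"
          then have "g = 3 \<or> g = 4 \<or> g = 5" using g by auto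
          then have "3 dvd t" using gs gt q sq by auto
          moreover have "\<not> 6 dvd t" "\<not> 9 dvd t"
            using maxg[of 6] maxg[of 9] q sq by auto
          ultimately have "t mod 18 = 3 \<or> t mod 18 = 15" by presburger
          moreover have "torus_colorable 5 18 3"
            by (rule torus_colorable_slope_dvd[where d = 3 and e = "- 1"]) auto
          moreover have "torus_colorable 5 18 15"
            by (rule torus_colorable_slope_dvd[where d = 3 and e = "- 4"]) auto
          ultimately show ?thesis using torus_colorable_mod[of 5 18 t] q sq by auto
        next
          assume q: "r = 5" "q = 5"
          then have "g = 3 \<or> g = 4 \<or> g = 5" using g by auto
          then show ?thesis using gs q sq by auto
        next
          assume q: "r = 7" "q = 2"
          then have "g = 3 \<or> g = 4 \<or> g = 5 \<or> g = 6 \<or> g = 7" using g by auto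
          then have "5 dvd t" using gs gt q sq by auto
          moreover have "\<not> 10 dvd t"
            using maxg[of 10] q sq by auto
          ultimately have "t mod 10 = 5" by presburger
          moreover have "torus_colorable 7 10 5"
            by (rule torus_colorable_slope_dvd[where d = 1 and e = "- 1"]) auto
          ultimately show ?thesis using torus_colorable_mod[of 7 10 t] q sq by auto
        qed
      next
        case False
        then have q: "q \<ge> 2" by simp
        have r579: "r = 5 \<or> r = 7 \<or> r \<ge> 9"
          using odd easy(5) by presburger
        have "4 * q + 1 \<le> r * (q - 1)"
          using r579
        proof (elim disjE)
          assume "r \<ge> 9"
          then have "9 * (q - 1) \<le> r * (q - 1)"
            using q by (intro mult_right_mono) auto
          then show ?thesis using q by simp
        qed (use False q in auto)
        then show ?thesis
          using sq q by (intro wide[of "q - 1"]) auto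
      qed
    next
      assume sq: "s = 4 * q + 1"
      show ?thesis
      proof (cases "q \<le> 2")
        case True
        then have "q = 0 \<or> q = 1 \<or> q = 2" using s sq by auto
        then show ?thesis
        proof (elim disjE)
          assume "q = 0"
          then have "g \<le> 1" using zdvd_imp_le[OF gs] s sq by simp
          then show ?thesis using g by simp
        next
          assume "q = 1"
          then have s5: "s = 5" using sq by simp
          have "g \<le> 5" using zdvd_imp_le[OF gs] s5 by simp
          then have "g = 3 \<or> g = 4 \<or> g = 5" using g by auto
          then have "5 dvd t" using gs gt s5 by auto
          then show ?thesis
            using torus_colorable_length_5[of r t] s5 easy by simp
        next
          assume "q = 2"
          then have s9: "s = 9" using sq by simp
          have "g \<le> 9" using zdvd_imp_le[OF gs] s9 by simp
          then have "g = 3 \<or> g = 4 \<or> g = 5 \<or> g = 6 \<or> g = 7 \<or> g = 8 \<or> g = 9" using g by auto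
          then have "3 dvd g" using gs s9 by auto
          then have "3 dvd t" using gt by (rule dvd_trans)
          then show ?thesis
            using torus_colorable_length_9[of r t] maxg[of 9] s9 easy by simp
        qed
      next
        case q3: False
        show ?thesis
        proof (cases "4 * q \<le> r * (q - 2)")
          case True
          then show ?thesis
            using sq q3 by (intro wide[of "q - 2"]) auto
        next
          case False
          have r12: "r \<le> 11"
          proof (rule ccontr)
            assume "\<not> ?thesis"
            then have "12 * (q - 2) \<le> r * (q - 2)"
              using q3 by (intro mult_right_mono) auto
            then show False using False q3 by simp
          qed
          have rs: "r = 5 \<or> r = 6 \<or> r = 7 \<or> r = 9 \<or> r = 10 \<or> r = 11"
            using r12 easy(3,5) by presburger
          have "q = 3 \<or> (q = 4 \<and> r \<le> 7) \<or> (q = 5 \<and> r \<le> 6) \<or> (r = 5 \<and> (q = 6 \<or> q = 7 \<or> q = 8 \<or> q = 9))"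
            using rs False q3 by (elim disjE) auto
          then show ?thesis
          proof (elim disjE conjE)
            assume "q = 3"
            then have "g dvd 13" using gs sq by simp
            moreover have "g = 3 \<or> g = 4 \<or> g = 5 \<or> g = 6 \<or> g = 7 \<or> g = 8 \<or> g = 9 \<or> g = 10 \<or> g = 11"
              using g r12 by auto
            ultimately show ?thesis by auto
          next
            assume q: "q = 4" "r \<le> 7"
            then have "g dvd 17" using gs sq by simp
            moreover have "g = 3 \<or> g = 4 \<or> g = 5 \<or> g = 6 \<or> g = 7"
              using g q by auto
            ultimately show ?thesis by auto
          next
            assume q: "q = 5" "r \<le> 6"
            then have "g dvd 21" using gs sq by simp
            moreover have "g = 3 \<or> g = 4 \<or> g = 5 \<or> g = 6"
              using g q by auto
            ultimately have "g = 3" by auto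
            then have t3: "3 dvd t" using gt by simp
            have s21: "s = 21" using q sq by simp
            have "r \<noteq> 6" using easy(4) t3 s21 by auto
            then have r5: "r = 5" using q easy by simp
            have "\<not> 7 dvd t" "\<not> 7 dvd 5 + t"
              using maxg[of 7] maxh[of 7] s21 r5 by auto
            then have tt: "t mod 21 = 3 \<or> t mod 21 = 6 \<or> t mod 21 = 12 \<or> t mod 21 = 15 \<or> t mod 21 = 18"
              using t3 by presburger
            have "torus_colorable 5 21 3" "torus_colorable 5 21 6" "torus_colorable 5 21 12"
              by (rule torus_colorable_slope_dvd[where d = 3 and e = "- 1"]; simp)+
            moreover have "torus_colorable 5 21 18"
              by (rule torus_colorable_slope_dvd[where d = 3 and e = "- 4"]) auto
            \<comment> \<open>For shift 15 no \<open>e\<close> works with the only possible value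
              \<open>d = 3\<close>, so the three horizontal circuits of length 35 serve as
              columns.\<close>
            moreover have "torus_colorable 3 35 17"
              by (rule torus_colorable_slope_dvd[where d = 5 and e = "- 2"]) auto
            then have "torus_colorable 5 21 15"
              by (rule_tac torus_colorable_rotateI[where g = 3 and a = 7 and b = 5 and k = 4 and m = 3]) auto
            ultimately show ?thesis
              using tt torus_colorable_mod[of 5 21 t] s21 r5 by (elim disjE) simp_all
          next
            assume q: "r = 5" "q = 6"
            then have "g = 3 \<or> g = 4 \<or> g = 5" using g by auto
            then have "5 dvd t" using gs gt q sq by auto
            moreover have "\<not> 25 dvd t" "\<not> 25 dvd 5 + t"
              using maxg[of 25] maxh[of 25] q sq by auto
            ultimately have tt: "t mod 25 = 5 \<or> t mod 25 = 10 \<or> t mod 25 = 15" by presburger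
            have "torus_colorable 5 25 5"
              by (rule torus_colorable_slope_dvd[where d = 1 and e = 0]) auto
            moreover have "torus_colorable 5 25 10"
              by (rule torus_colorable_slope_dvd[where d = 4 and e = "- 2"]) auto
            moreover have "torus_colorable 5 25 15"
              by (rule torus_colorable_slope_dvd[where d = 1 and e = "- 1"]) auto
            ultimately show ?thesis
              using tt torus_colorable_mod[of 5 25 t] q sq by auto
          next
            assume q: "r = 5" "q = 7"
            then have "g = 3 \<or> g = 4 \<or> g = 5" using g by auto
            then show ?thesis using gs q sq by auto
          next
            assume q: "r = 5" "q = 8"
            then have "g = 3 \<or> g = 4 \<or> g = 5" using g by auto
            then have "3 dvd t" using gs gt q sq by auto
            then obtain b where b: "t = 3 * b" by blast
            \<comment> \<open>For six walks \<open>s - 1 = 32\<close> exceeds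
              \<open>r * d = 30\<close>. But \<open>3 dvd t\<close> makes the quantity to be bounded
              a multiple of 9, and it changes by 99 with each unit of \<open>f\<close>; so it can be
              brought down to at most \<open>9 * 10\<close>, which is exactly
              \<open>3 * 5 * 6\<close>.\<close>
            define f where "f = (- 4 - 2 * b) div 11"
            have "(5 - t) * 6 - (2 + 3 * f) * 33 = 9 * ((- 4 - 2 * b) - f * 11)"
              unfolding b by simp
            also have "\<dots> = 9 * ((- 4 - 2 * b) mod 11)"
              unfolding f_def by (simp only: minus_div_mult_eq_mod)
            finally have V: "(5 - t) * 6 - (2 + 3 * f) * 33 = 9 * ((- 4 - 2 * b) mod 11)" .
            have "torus_colorable 5 33 t"
            proof (rule torus_colorable_slope_dvd[where d = 6 and e = "2 + 3 * f"])
              show "3 dvd 5 - t - (2 + 3 * f)"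
                unfolding b by presburger
              show "(5 - t) * 6 - (2 + 3 * f) * 33 \<le> 3 * 5 * 6"
                unfolding V using pos_mod_bound[of 11 "- 4 - 2 * b"] by simp
            qed (unfold V, simp_all)
            then show ?thesis using q sq by simp
          next
            assume q: "r = 5" "q = 9"
            then have "g = 3 \<or> g = 4 \<or> g = 5" using g by auto
            then show ?thesis using gs q sq by auto
          qed
        qed
      qed
    qed
  qed
qed

section \<open>Reduction by symmetry to the case just treated\<close>

text \<open>Two positive counts with product above 2 include one that is at least 3, or both are 2.
  A mirror image moves the large one to \<open>gcd s t\<close>; if both are 2, then \<open>r\<close>
  and \<open>s\<close> are even.\<close>

lemma torus_colorable_max_column:
  assumes "r \<ge> 1" "s \<ge> 1" "gcd s t \<le> r" "gcd s (r + t) \<le> r" "gcd s t * gcd s (r + t) > 2"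
  shows "torus_colorable r s t"
proof -
  have pos: "gcd s t > 0" "gcd s (r + t) > 0" using assms(2) by auto
  have "gcd s t \<ge> 3 \<or> gcd s (r + t) \<ge> 3 \<or> gcd s t = 2 \<and> gcd s (r + t) = 2"
  proof (rule ccontr)
    assume "\<not> ?thesis"
    then have "gcd s t = 1 \<and> gcd s (r + t) \<le> 2 \<or> gcd s t \<le> 2 \<and> gcd s (r + t) = 1"
      using pos by linarith
    then show False using assms(5) by auto
  qed
  then consider "gcd s t \<ge> 3" | "gcd s (r + t) \<ge> 3" | "gcd s t = 2" "gcd s (r + t) = 2"
    by blast
  then show ?thesis
  proof cases
    case 1
    then show ?thesis using assms torus_colorable_max_column_aux by simp
  next
    case 2
    have "gcd s (- r - t) = gcd s (r + t)"
      by (metis gcd_neg2 minus_add_distrib uminus_add_conv_diff add_uminus_conv_diff)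
    then have "torus_colorable r s (- r - t)"
      using 2 assms by (intro torus_colorable_max_column_aux[OF _ _ refl]) auto
    then show ?thesis by (rule torus_colorable_mirror)
  next
    case 3
    have "even s" "even t" "even (r + t)"
      using 3 by (metis gcd_dvd1 gcd_dvd2)+
    then show ?thesis
      using assms(1) by (intro torus_colorable_even) auto
  qed
qed

text \<open>Rotation makes the largest count \<open>gcd s t\<close> the number of columns; by
  \<open>gcd_rotate\<close> the other two counts are only permuted.\<close>

lemma torus_colorable_max_row:
  assumes "r \<ge> 1" "s \<ge> 1" "r \<le> gcd s t" "gcd s (r + t) \<le> gcd s t" "r * gcd s (r + t) > 2"
  shows "torus_colorable r s t"
proof -
  obtain a b k m where *: "s = gcd s t * a" "t = gcd s t * b" "1 + b * k = m * a" "gcd s t > 0" "a > 0"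
    by (rule rotation_witness[of s "gcd s t" t]) (use assms(2) in simp_all)
  note G = gcd_rotate[OF _ *(4,1,2,3), of r]
  have "torus_colorable (gcd s t) (r * a) (r * k - gcd s t)"
  proof (rule torus_colorable_max_column)
    show "1 \<le> gcd s t" using *(4) by linarith
    show "1 \<le> r * a"
      using assms(1) *(5) mult_pos_pos[of r a] by linarith
  qed (use G assms in \<open>simp_all add: mult.commute\<close>)
  then show ?thesis
    using * by (rule_tac torus_colorable_rotateI)
qed

lemma torus_colorable_of_circuits:
  assumes "r \<ge> 1" "s \<ge> 1" "r * gcd s t > 2" "r * gcd s (r + t) > 2" "gcd s t * gcd s (r + t) > 2"
  shows "torus_colorable r s t"
proof -
  consider "gcd s t \<le> r" "gcd s (r + t) \<le> r" | "r \<le> gcd s t" "gcd s (r + t) \<le> gcd s t"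
    | "r \<le> gcd s (r + t)" "gcd s t \<le> gcd s (r + t)"
    by linarith
  then show ?thesis
  proof cases
    case 1
    then show ?thesis using assms by (intro torus_colorable_max_column) auto
  next
    case 2
    then show ?thesis using assms by (intro torus_colorable_max_row) auto
  next
    case 3
    have "gcd s (- r - t) = gcd s (r + t)"
      by (metis gcd_neg2 minus_add_distrib uminus_add_conv_diff add_uminus_conv_diff)
    then have "torus_colorable r s (- r - t)"
      using 3 assms by (intro torus_colorable_max_row) auto
    then show ?thesis by (rule torus_colorable_mirror)
  qed
qed

section \<open>Circuits of the torus graph\<close>

text \<open>Lattice columns 0 and \<open>r + 1\<close> are columns \<open>r\<close> and 1 shifted by
  the period \<open>(r, t)\<close>, so the adjacencies across the seam are ordinary lattice
  edges.\<close>

lemma colorable_if_torus_colorable: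
  assumes r: "r \<ge> 1" and s: "s \<ge> 1" and col: "torus_colorable r s t"
  shows "colorable 4 (T_verts r s) (T_adj r s t)"
proof -
  obtain f where f: "lattice_coloring f" "period f 0 s" "period f r t"
    using col torus_colorable_def by blast
  have wrap: "f x (wrap s y) = f x y" for x y
  proof -
    have "y = wrap s y + ((y - 1) div s) * s"
      unfolding wrap_def using div_mult_mod_eq[of "y - 1" s] by linarith
    then show ?thesis
      using period_mult[OF f(2), of "(y - 1) div s"] unfolding period_def
      by (metis add.right_neutral mult_zero_right)
  qed
  have shift: "f (x + r) (y + t) = f x y" for x y
    using f(3) unfolding period_def by blast
  have shift0: "f r (y + t) = f 0 y" "f r (t + y) = f 0 y" for y
    using shift[of 0 y] by (simp_all add: add.commute)
  have shift1: "f 1 (y - t) = f (r + 1) y" for y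
    using shift[of 1 "y - t"] by (simp add: add.commute)
  have fs: "f x (y + 1) \<noteq> f x y" "f (x + 1) y \<noteq> f x y" "f (x + 1) (y - 1) \<noteq> f x y"
    "0 \<le> f x y" "f x y < 4" for x y
    using f(1) unfolding lattice_coloring_def by metis+
  have fs': "f x (y - 1) \<noteq> f x y" "f (x - 1) y \<noteq> f x y" "f (x - 1) (y + 1) \<noteq> f x y" for x y
    using fs(1)[of x "y - 1"] fs(2)[of "x - 1" y] fs(3)[of "x - 1" "y + 1"] by auto
  have A: "f r (y + t + 1) \<noteq> f 1 y" "f r (y + t) \<noteq> f 1 y" for y
    using fs'(2)[of 1 y] fs'(3)[of 1 y] shift[of 0 y] shift[of 0 "y + 1"]
    by (simp_all add: algebra_simps)
  have B: "f 1 (y - t) \<noteq> f r y" "f 1 (y - t - 1) \<noteq> f r y" for y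
    using fs(2)[of r y] fs(3)[of r y] shift1[of y] shift1[of "y - 1"]
    by (simp_all add: algebra_simps)
  have nbr: "f x y \<noteq> f i j" if "i \<in> {1..r}" "(x, y) \<in> set (T_nbrs r s t (i, j))" for i j x y
  proof (cases "r = 1")
    case True
    then show ?thesis
      using that A[of j] B[of j] fs(1)[of 1 j] fs'(1)[of 1 j]
      by (auto simp: T_nbrs_def wrap add.assoc diff_diff_eq)
  next
    case False
    then show ?thesis
      using that A[of j] B[of j] fs(1-3)[of i j] fs'(1-3)[of i j]
      by (auto simp: T_nbrs_def wrap split: if_splits)
  qed
  show ?thesis
    unfolding colorable_def
  proof (intro exI[of _ "\<lambda>(i, j). nat (f i j)"] conjI ballI impI)
    fix v assume "v \<in> T_verts r s"
    show "(case v of (i, j) \<Rightarrow> nat (f i j)) < 4"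
      using fs(4,5) by (cases v) (auto simp: nat_less_iff)
  next
    fix v w assume v: "v \<in> T_verts r s" and w: "T_adj r s t v w"
    obtain i j x y where vw: "v = (i, j)" "w = (x, y)" by (cases v, cases w)
    have "f x y \<noteq> f i j"
      using v w unfolding vw T_adj_def T_verts_def by (intro nbr) auto
    then show "(case v of (i, j) \<Rightarrow> nat (f i j)) \<noteq> (case w of (i, j) \<Rightarrow> nat (f i j))"
      using fs(4)[of i j] fs(4)[of x y] unfolding vw by (simp add: eq_nat_nat_iff)
  qed
qed

section \<open>Lengths of the normal circuits\<close>

lemma card_orbit_translation:
  assumes step: "\<And>p. f (\<pi> p) = \<pi> (p + 1)" and eq: "\<And>p q. \<pi> p = \<pi> q \<longleftrightarrow> L dvd p - q" and L: "L > 0"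
  shows "card (orbit f (\<pi> (0::int))) = nat L"
proof -
  have pow: "(f ^^ k) (\<pi> 0) = \<pi> (int k)" for k
    by (induction k) (auto simp: step add.commute)
  have "orbit f (\<pi> 0) = \<pi> ` {0..<L}"
  proof (intro equalityI subsetI)
    fix v assume "v \<in> orbit f (\<pi> 0)"
    then obtain k where "v = \<pi> (int k)"
      unfolding orbit_altdef pow by blast
    also have "\<dots> = \<pi> (int k mod L)"
      unfolding eq by (simp add: minus_mod_eq_mult_div)
    finally show "v \<in> \<pi> ` {0..<L}"
      using L by auto
  next
    fix v assume "v \<in> \<pi> ` {0..<L}"
    then obtain p where p: "0 \<le> p" "v = \<pi> p" by auto
    \<comment> \<open>\<open>orbit\<close> consists of the iterates with positive exponent, so the
      start itself is reached only after a full turn; hence \<open>p + L\<close> in place of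
      \<open>p\<close>.\<close>
    then have "v = \<pi> (int (nat (p + L)))"
      using L by (simp add: eq)
    moreover have "nat (p + L) > 0" using p L by simp
    ultimately show "v \<in> orbit f (\<pi> 0)"
      unfolding orbit_altdef pow by blast
  qed
  moreover have "inj_on \<pi> {0..<L}"
  proof (rule inj_onI)
    fix p q assume "p \<in> {0..<L}" "q \<in> {0..<L}" "\<pi> p = \<pi> q"
    then have "L dvd p - q" "\<bar>p - q\<bar> < L" unfolding eq by auto
    then show "p = q" using dvd_imp_le_int[of "p - q" L] by (cases "p = q") auto
  qed
  ultimately show ?thesis
    by (simp add: card_image)
qed

lemma wrap_eq_iff: "wrap m x = wrap m y \<longleftrightarrow> m dvd x - y"
  by (simp add: wrap_def mod_eq_dvd_iff)

lemma wrap_wrap_add: "wrap m (wrap m x + y) = wrap m (x + y)"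
  by (simp add: wrap_def algebra_simps mod_simps)

lemma wrap_wrap_diff: "wrap m (wrap m x - y) = wrap m (x - y)"
  using wrap_wrap_add[of m x "- y"] by simp

text \<open>The covering map from the plane to the torus. The quotient \<open>(x - 1) div r\<close>
  counts the passages from column \<open>r\<close> to column 1, each of which shifts by
  \<open>- t\<close>.\<close>

definition reduce :: "int \<Rightarrow> int \<Rightarrow> int \<Rightarrow> int \<Rightarrow> int \<Rightarrow> vertex" where
  "reduce r s t x y = (wrap r x, wrap s (y - t * ((x - 1) div r)))"

lemma reduce_vertex: "(i, j) \<in> T_verts r s \<Longrightarrow> reduce r s t i j = (i, j)"
  by (auto simp: reduce_def T_verts_def wrap_def)

lemma wrap_add_1:
  assumes "r \<ge> 1"
  shows "if wrap r x = r then wrap r (x + 1) = 1 \<and> (x + 1 - 1) div r = (x - 1) div r + 1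
    else wrap r (x + 1) = wrap r x + 1 \<and> (x + 1 - 1) div r = (x - 1) div r"
proof -
  define q m where "q = (x - 1) div r" and "m = (x - 1) mod r"
  have x: "x = q * r + m + 1" and m: "0 \<le> m" "m < r"
    using assms by (auto simp: q_def m_def)
  have "x mod r = (m + 1) mod r" "x div r = q + (m + 1) div r"
    unfolding x using assms by (simp_all add: add.assoc)
  moreover have "m + 1 < r" if "m + 1 \<noteq> r" using m that by linarith
  ultimately show ?thesis
    using m assms unfolding wrap_def q_def[symmetric] m_def[symmetric] by auto
qed

lemma T_step_reduce:
  assumes "r \<ge> 1"
  shows "T_step r s t Horizontal (reduce r s t x y) = reduce r s t (x + 1) y"
    and "T_step r s t Diagonal (reduce r s t x y) = reduce r s t (x + 1) (y - 1)"
  using wrap_add_1[OF assms, of x] wrap_wrap_diff[of s _ 0]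
  by (auto simp: reduce_def wrap_wrap_diff algebra_simps split: if_splits)

text \<open>The fibers of the covering are the cosets of the lattice spanned by
  \<open>(0, s)\<close> and \<open>(r, t)\<close>.\<close>

lemma reduce_eq_iff:
  assumes "r \<ge> 1"
  shows "reduce r s t x y = reduce r s t x' y' \<longleftrightarrow>
    r dvd x - x' \<and> s dvd (y - y') - t * ((x - x') div r)"
proof (cases "r dvd x - x'")
  case True
  then obtain m where m: "x = x' + m * r" by (auto simp: dvd_def algebra_simps)
  have "(x - 1) div r = (x' - 1 + m * r) div r" unfolding m by (simp add: algebra_simps)
  also have "\<dots> = (x' - 1) div r + m" using assms by simp
  finally have "(x - 1) div r = (x' - 1) div r + (x - x') div r" unfolding m using assms by simp
  then show ?thesis
    using True by (simp add: reduce_def wrap_eq_iff algebra_simps)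
qed (simp add: reduce_def wrap_eq_iff)

lemma dvd_mult_iff_div_gcd:
  fixes s u m :: int
  assumes "s \<noteq> 0"
  shows "s dvd u * m \<longleftrightarrow> s div gcd s u dvd m"
proof -
  define g where "g = gcd s u"
  have g: "g \<noteq> 0" using assms by (simp add: g_def)
  obtain a b where ab: "s = g * a" "u = g * b"
    unfolding g_def by (metis dvdE gcd_dvd1 gcd_dvd2)
  have "coprime a b"
    using div_gcd_coprime[of s u] assms g ab unfolding g_def[symmetric] by simp
  then show ?thesis
    unfolding g_def[symmetric] using g ab by (simp add: coprime_dvd_mult_right_iff mult.assoc)
qed

lemma normal_circuit_length_vertical:
  assumes "s \<ge> 1"  "v \<in> T_verts r s"
  shows "normal_circuit_length r s t Vertical v = nat s"
proof -
  obtain i j where v: "v = (i, j)" by (cases v)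
  have j: "wrap s j = j" using assms(2) by (auto simp: v T_verts_def wrap_def)
  have "card (orbit (T_step r s t Vertical) (i, wrap s (j + 0))) = nat s"
    using assms(1) by (intro card_orbit_translation[where \<pi> = "\<lambda>p. (i, wrap s (j + p))"])
      (auto simp: wrap_wrap_add wrap_eq_iff add.assoc)
  then show ?thesis
    by (simp add: normal_circuit_length_def normal_circuit_def v j)
qed

text \<open>In the plane \<open>p\<close> steps are the translation by \<open>(p, - c * p)\<close>.
  It is a period iff \<open>p = r * m\<close> with \<open>s dvd (c * r + t) * m\<close>, that is,
  with \<open>m\<close> a multiple of \<open>s div gcd s (c * r + t)\<close>.\<close>

lemma normal_circuit_length_transversal:
  assumes r: "r \<ge> 1" and s: "s \<ge> 1" and v: "v \<in> T_verts r s"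
    and d: "d = Horizontal \<and> c = 0 \<or> d = Diagonal \<and> c = 1"
  shows "normal_circuit_length r s t d v = nat (r * (s div gcd s (c * r + t)))"
proof -
  obtain i j where ij: "v = (i, j)" by (cases v)
  let ?\<pi> = "\<lambda>p. reduce r s t (i + p) (j - c * p)"
  have "card (orbit (T_step r s t d) (?\<pi> 0)) = nat (r * (s div gcd s (c * r + t)))"
  proof (rule card_orbit_translation)
    show "T_step r s t d (?\<pi> p) = ?\<pi> (p + 1)" for p
      using T_step_reduce[OF r, of s t "i + p" "j - c * p"] d by (auto simp: algebra_simps)
    show "0 < r * (s div gcd s (c * r + t))"
      using r s by (simp add: pos_imp_zdiv_pos_iff zdvd_imp_le)
    show "?\<pi> p = ?\<pi> q \<longleftrightarrow> r * (s div gcd s (c * r + t)) dvd p - q" for p q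
    proof (cases "r dvd p - q")
      case True
      then obtain m where m: "p = q + r * m" by (metis diff_add_cancel dvdE add.commute)
      have "i + p - (i + q) = r * m"
        "j - c * p - (j - c * q) - t * (r * m div r) = - ((c * r + t) * m)"
        using r unfolding m by (simp_all add: algebra_simps)
      then have "?\<pi> p = ?\<pi> q \<longleftrightarrow> s dvd - ((c * r + t) * m)"
        unfolding reduce_eq_iff[OF r] by simp
      also have "\<dots> \<longleftrightarrow> s div gcd s (c * r + t) dvd m"
        using s by (simp add: dvd_mult_iff_div_gcd)
      finally show ?thesis using r m by simp
    next
      case False
      then show ?thesis
        unfolding reduce_eq_iff[OF r] by (auto dest: dvd_mult_left)
    qed
  qed
  then show ?thesis
    using v by (simp add: normal_circuit_length_def normal_circuit_def ij reduce_vertex)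
qed

text \<open>Decreasing lengths mean increasing counts \<open>1 \<le> A \<le> B \<le> C\<close>. The
  excluded pairs are exactly those with \<open>A * B \<le> 2\<close>, and \<open>A * B\<close> is
  the smallest of the three products.\<close>

lemma circuit_counts_sorted:
  fixes n A B C :: int and a b c :: nat
  assumes n: "n > 0" and eq: "int a * A = n" "int b * B = n" "int c * C = n" and ord: "a \<ge> b" "b \<ge> c"
    and ne: "(of_int n / of_nat a, of_int n / of_nat b) \<noteq> (1 :: rat, 1 :: rat)"
      "(of_int n / of_nat a, of_int n / of_nat b) \<noteq> (1 :: rat, 2 :: rat)"
  shows "A * B > 2 \<and> A * C > 2 \<and> B * C > 2"
proof -
  have quot: "of_int n / of_nat x = (of_int X :: rat)" if "int x * X = n" for x X
  proof -
    have "x \<noteq> 0" using that n by (cases x) auto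
    moreover have "of_int n = (of_nat x * of_int X :: rat)"
      unfolding that[symmetric] by simp
    ultimately show ?thesis by simp
  qed
  have pos: "X > 0" if "int x * X = n" for x X
    using n that[symmetric] by (simp add: zero_less_mult_iff)
  have le: "X \<le> Y" if "int x * X = n" "int y * Y = n" "x \<ge> y" for x y X Y
  proof (rule ccontr)
    assume "\<not> X \<le> Y"
    moreover have "y > 0" using that(2) n by (cases y) auto
    ultimately have "int y * Y < int y * X" by simp
    also have "\<dots> \<le> int x * X" using that pos[OF that(1)] by (intro mult_right_mono) auto
    finally show False using that by simp
  qed
  have AB: "\<not> (A = 1 \<and> B = 1)" "\<not> (A = 1 \<and> B = 2)"
    using ne unfolding quot[OF eq(1)] quot[OF eq(2)] by auto
  have o: "1 \<le> A" "A \<le> B" "B \<le> C"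
    using pos[OF eq(1)] le[OF eq(1,2) ord(1)] le[OF eq(2,3) ord(2)] by auto
  have "A * B > 2"
  proof (cases "A = 1")
    case False
    then have "2 * 2 \<le> A * B" using o by (intro mult_mono) auto
    then show ?thesis by simp
  qed (use AB o in auto)
  moreover have "A * B \<le> A * C" "A * C \<le> B * C"
    using o by (auto intro: mult_left_mono mult_right_mono)
  ultimately show ?thesis by auto
qed

theorem theorem1p3:
  fixes r s t n :: int and a b c :: nat and v :: vertex
  assumes "r \<ge> 1" and "s \<ge> 1" and "0 \<le> t" and "t \<le> s - 1"
    and "T_simple r s t"
    and "n = r * s"
    and "v \<in> T_verts r s"
    and "{#a, b, c#} = {#normal_circuit_length r s t Vertical v,
                         normal_circuit_length r s t Horizontal v,
                         normal_circuit_length r s t Diagonal v#}"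
    and "a \<ge> b" and "b \<ge> c"
    and "(of_int n / of_nat a, of_int n / of_nat b) \<noteq> (1 :: rat, 1 :: rat)"
    and "(of_int n / of_nat a, of_int n / of_nat b) \<noteq> (1 :: rat, 2 :: rat)"
  shows "colorable 4 (T_verts r s) (T_adj r s t)"
proof -
  define X Y Z where "X = normal_circuit_length r s t Vertical v"
    and "Y = normal_circuit_length r s t Horizontal v"
    and "Z = normal_circuit_length r s t Diagonal v"
  have n: "n > 0" using assms(1,2,6) by simp
  have X: "int X * r = n"
    using assms(1,2,6) normal_circuit_length_vertical[OF assms(2,7)] by (simp add: X_def)
  have transversal: "int (nat (r * (s div gcd s u))) * gcd s u = n" for u
  proof -
    have "s div gcd s u > 0"
      using assms(2) by (simp add: pos_imp_zdiv_pos_iff zdvd_imp_le)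
    then show ?thesis using assms(1,6) by simp
  qed
  have Y: "int Y * gcd s t = n"
    using transversal[of t] normal_circuit_length_transversal[OF assms(1,2,7), of Horizontal 0 t]
    by (simp add: Y_def)
  have Z: "int Z * gcd s (r + t) = n"
    using transversal[of "r + t"] normal_circuit_length_transversal[OF assms(1,2,7), of Diagonal 1 t]
    by (simp add: Z_def)
  have "{#a, b, c#} = {#X, Y, Z#}"
    using assms(8) by (simp add: X_def Y_def Z_def)
  then have "a = X \<and> b = Y \<and> c = Z \<or> a = X \<and> b = Z \<and> c = Y \<or> a = Y \<and> b = X \<and> c = Z \<or>
      a = Y \<and> b = Z \<and> c = X \<or> a = Z \<and> b = X \<and> c = Y \<or> a = Z \<and> b = Y \<and> c = X"
    by (auto simp: add_eq_conv_ex add_mset_eq_single)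
  \<comment> \<open>The three inequalities are symmetric in the counts, so each of the six orders
    gives the same conclusion.\<close>
  then have "r * gcd s t > 2 \<and> r * gcd s (r + t) > 2 \<and> gcd s t * gcd s (r + t) > 2"
    using circuit_counts_sorted[OF n _ _ _ assms(9-12)] X Y Z
    by (elim disjE conjE) (metis mult.commute)+
  then show ?thesis
    using assms(1,2) by (intro colorable_if_torus_colorable torus_colorable_of_circuits) auto
qed

end
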